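(* Let Assumptions 1 and 2 of the context hold and let $x_0\in\mathsf X_0$. Let the matrices $\{Y_k^i,\ k\in\mathsf K_l,\ i\in\mathsf N\}$ be positive definite. Let $\{x_k^\star,\lambda_k^i,\ k\in\mathsf K,\ \mu_k^{i\star},\ k\in\mathsf K_l,\ i\in\mathsf N\}$ be a solution of LCS1. Then $\{u_k^{i\star},\ k\in\mathsf K_l,\ i\in\mathsf N\}$ given by $$u_k^{i\star}=-(R_k^{ii})^{-1}\big({B_k^i}'\lambda_{k+1}^i-[N_k^i]_i'\mu_k^{i\star}\big)$$ is a generalized open-loop Nash equilibrium (GOLNE) for DGC.
   Context: Notation. A prime denotes transpose; $\|a\|_A:=a'Aa$; $\mathrm{col}\{\cdot\}$ stacks vectors or matrices vertically; $0\le x\perp y\ge0$ means $x\ge0$, $y\ge0$ (componentwise) and $x'y=0$. $\mathsf N=\{1,\dots,N\}$ (players), $\mathsf K=\{0,\dots,K\}$, $\mathsf K_l=\mathsf K\setminus\{K\}$, $-i=\mathsf N\setminus\{i\}$. The game (DGC). The state $x_k\in\mathbb R^n$ evolves as $x_{k+1}=A_kx_k+\sum_{i\in\mathsf N}B_k^iu_k^i$, $k\in\mathsf K_l$, with given $x_0\in\mathbb R^n$, where $A_k\in\mathbb R^{n\times n}$, $B_k^i\in\mathbb R^{n\times m_i}$ and $u_k^i\in\mathbb R^{m_i}$ is player $i$'s action. Put $\mathsf u_k=\mathrm{col}\{u_k^i\}_{i=1}^N\in\mathbb R^m$, $m=\sum_im_i$. Player $i$'s constraints are $M_k^ix_k+N_k^i\mathsf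 u_k+r_k^i\ge0$, $k\in\mathsf K_l$, with $M_k^i\in\mathbb R^{c_i\times n}$, $N_k^i\in\mathbb R^{c_i\times m}$, $r_k^i\in\mathbb R^{c_i}$; $[N_k^i]_j\in\mathbb R^{c_i\times m_j}$ is the block of columns of $N_k^i$ multiplying $u_k^j$. Player $i$'s strategy is $\mathsf u^i=\mathrm{col}\{u_k^i\}_{k=0}^{K-1}$, and $\mathsf u^{-i}$ collects the strategies of the other players. Player $i$ minimizes $$J^i(\mathsf u^i,\mathsf u^{-i})=\tfrac12\|x_K\|_{Q_K^i}+{p_K^i}'x_K+\tfrac12\sum_{k\in\mathsf K_l}\Big(\|x_k\|_{Q_k^i}+2{p_k^i}'x_k+\sum_{j\in\mathsf N}\|u_k^j\|_{R_k^{ij}}\Big),$$ with $Q_k^i\in\mathbb R^{n\times n}$ symmetric, $p_k^i\in\mathbb R^n$, $R_k^{ij}\in\mathbb R^{m_j\times m_j}$, $R_k^{ii}$ symmetric. $R(x_0)$ is the set of joint strategies $(\mathsf u^i,\mathsf u^{-i})\in\mathbb R^{Km}$ for which, with the state generated from $x_0$, all players' constraints hold at all $k\in\mathsf K_l$; $\Omega=\{(x_0,(\mathsf u^i,\mathsf u^{-i})):(\mathsf u^i,\mathsf u^{-i})\in R(x_0)\}$; $\mathsf X_0=\{x_0\in\mathbb R^n: R(x_0)\ne\emptyset\}$; $\mathsf U^i(\mathsf u^{-i})=\{\mathsf u^i\in\mathbb R^{Km_i}:(\mathsf u^i,\mathsf u^{-i})\in R(x_0)\}$. GOLNE. A profile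 $\mathsf u^\star\in R(x_0)$ is a generalized open-loop Nash equilibrium for DGC if for each $i\in\mathsf N$: $J^i(\mathsf u^{i\star},\mathsf u^{-i\star})\le J^i(\mathsf u^i,\mathsf u^{-i\star})$ for all $\mathsf u^i\in\mathsf U^i(\mathsf u^{-i\star})$. Assumption 1. (i) $\Omega\ne\emptyset$, and for every $x_0\in\mathsf X_0$, $R(x_0)$ is bounded. (ii) The matrices $[N_k^i]_i$, $k\in\mathsf K_l$, $i\in\mathsf N$, have full rank. (iii) The matrices $R_k^{ii}$, $k\in\mathsf K_l$, $i\in\mathsf N$, are positive definite. Assumption 2. For each $i\in\mathsf N$ the backward symmetric matrix Riccati equation $$E_k^i=A_k'E_{k+1}^iA_k+Q_k^i-A_k'E_{k+1}^iB_k^i(Y_k^i)^{-1}{B_k^i}'E_{k+1}^iA_k,\quad E_K^i=Q_K^i,$$ admits a solution $\{E_k^i,\ k\in\mathsf K\}$, and thus the matrices $Y_k^i=R_k^{ii}+{B_k^i}'E_{k+1}^iB_k^i$, $k\in\mathsf K_l$, $i\in\mathsf N$, are invertible. LCS1. A solution of LCS1 is a collection $\{x_k^\star,\lambda_k^i\in\mathbb R^n,\ k\in\mathsf K,\ \mu_k^{i\star}\in\mathbb R^{c_i},\ k\in\mathsf K_l,\ i\in\mathsf N\}$ such that for all $k\in\mathsf K_l$, $i\in\mathsf N$ $$x_{k+1}^\star=A_kx_k^\star-\sum_{j\in\mathsf N}B_k^j(R_k^{jj})^{-1}\big({B_k^j}'\lambda_{k+1}^j-[N_k^j]_j'\mu_k^{j\star}\big),$$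 $$\lambda_k^i=Q_k^ix_k^\star+p_k^i+A_k'\lambda_{k+1}^i-{M_k^i}'\mu_k^{i\star},$$ $$0\le M_k^ix_k^\star-\sum_{j\in\mathsf N}[N_k^i]_j(R_k^{jj})^{-1}\big({B_k^j}'\lambda_{k+1}^j-[N_k^j]_j'\mu_k^{j\star}\big)+r_k^i\ \perp\ \mu_k^{i\star}\ge0,$$ with $x_0^\star=x_0$ and $\lambda_K^i=Q_K^ix_K^\star+p_K^i$. *)

theory Defs
  imports
    "Jordan_Normal_Form.Gauss_Jordan_Elimination"
    "Jordan_Normal_Form.DL_Rank"
    "HOL-Library.FuncSet"
    Complex_Main
begin

section \<open>Matrices and vectors\<close>

text \<open>The inverse; meaningful only for invertible matrices.\<close>

abbreviation matinv :: "real mat \<Rightarrow> real mat" where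
  "matinv A \<equiv> the (mat_inverse A)"

definition symmetric_matrix :: "real mat \<Rightarrow> bool" where
  "symmetric_matrix A \<longleftrightarrow> square_mat A \<and> A\<^sup>T = A"

definition quad :: "real mat \<Rightarrow> real vec \<Rightarrow> real" where
  "quad A a = a \<bullet> (A *\<^sub>v a)"

definition positive_definite :: "real mat \<Rightarrow> bool" where
  "positive_definite A \<longleftrightarrow> symmetric_matrix A \<and>
     (\<forall>v \<in> carrier_vec (dim_row A). v \<noteq> 0\<^sub>v (dim_row A) \<longrightarrow> 0 < quad A v)"

definition full_rank :: "real mat \<Rightarrow> bool" where
  "full_rank A \<longleftrightarrow> vec_space.rank (dim_row A) A = min (dim_row A) (dim_col A)"

definition col_stack :: "real vec list \<Rightarrow> real vec" where
  "col_stack vs = foldr append_vec vs vNil"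

definition complementary :: "real vec \<Rightarrow> real vec \<Rightarrow> bool" where
  "complementary x y \<longleftrightarrow> 0\<^sub>v (dim_vec x) \<le> x \<and> 0\<^sub>v (dim_vec y) \<le> y \<and>
     dim_vec x = dim_vec y \<and> x \<bullet> y = 0"

section \<open>The constrained dynamic game\<close>

text \<open>
  Players are the numbers 1, ..., \<open>nplayers\<close>; stages are 0, ..., \<open>horizon\<close>. All families are
  indexed by the player (or players) first and by the stage last, so that \<open>Rmat G i j k\<close> weights
  the action of player \<open>j\<close> at stage \<open>k\<close> in the cost of player \<open>i\<close>.
\<close>

record dgc =
  nplayers :: nat
  horizon :: nat
  sdim :: nat
  adim :: "nat \<Rightarrow> nat"
  cdim :: "nat \<Rightarrow> nat"
  Amat :: "nat \<Rightarrow> real mat"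
  Bmat :: "nat \<Rightarrow> nat \<Rightarrow> real mat"
  Mmat :: "nat \<Rightarrow> nat \<Rightarrow> real mat"
  Nmat :: "nat \<Rightarrow> nat \<Rightarrow> real mat"
  rvec :: "nat \<Rightarrow> nat \<Rightarrow> real vec"
  Qmat :: "nat \<Rightarrow> nat \<Rightarrow> real mat"
  pvec :: "nat \<Rightarrow> nat \<Rightarrow> real vec"
  Rmat :: "nat \<Rightarrow> nat \<Rightarrow> nat \<Rightarrow> real mat"

definition players :: "dgc \<Rightarrow> nat set" where
  "players G = {1..nplayers G}"

definition stages :: "dgc \<Rightarrow> nat set" where
  "stages G = {0..horizon G}"

definition action_stages :: "dgc \<Rightarrow> nat set" where
  "action_stages G = stages G - {horizon G}"

definition total_adim :: "dgc \<Rightarrow> nat" where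
  "total_adim G = (\<Sum>i\<in>players G. adim G i)"

definition is_dgc :: "dgc \<Rightarrow> bool" where
  "is_dgc G \<longleftrightarrow>
     (\<forall>k\<in>action_stages G. Amat G k \<in> carrier_mat (sdim G) (sdim G)) \<and>
     (\<forall>i\<in>players G. \<forall>k\<in>action_stages G.
        Bmat G i k \<in> carrier_mat (sdim G) (adim G i) \<and>
        Mmat G i k \<in> carrier_mat (cdim G i) (sdim G) \<and>
        Nmat G i k \<in> carrier_mat (cdim G i) (total_adim G) \<and>
        rvec G i k \<in> carrier_vec (cdim G i) \<and>
        (\<forall>j\<in>players G. Rmat G i j k \<in> carrier_mat (adim G j) (adim G j)) \<and>
        symmetric_matrix (Rmat G i i k)) \<and>
     (\<forall>i\<in>players G. \<forall>k\<in>stages G.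
        Qmat G i k \<in> carrier_mat (sdim G) (sdim G) \<and> symmetric_matrix (Qmat G i k) \<and>
        pvec G i k \<in> carrier_vec (sdim G))"

text \<open>
  The block of columns of \<open>Nmat G i k\<close> multiplying the action of player \<open>j\<close> in the stacked
  vector of all actions.
\<close>

definition Nblock :: "dgc \<Rightarrow> nat \<Rightarrow> nat \<Rightarrow> nat \<Rightarrow> real mat" where
  "Nblock G i j k = mat (cdim G i) (adim G j)
     (\<lambda>(a, b). Nmat G i k $$ (a, (\<Sum>l\<in>{1..<j}. adim G l) + b))"

text \<open>
  The strategy of a player (a column of one action per stage) is represented by the corresponding
  family of actions, extensional outside the action stages; a joint strategy is an extensional
  family of strategies.
\<close>

definition strategies :: "dgc \<Rightarrow> nat \<Rightarrow> (nat \<Rightarrow> real vec) set" where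
  "strategies G i = action_stages G \<rightarrow>\<^sub>E carrier_vec (adim G i)"

definition joint_strategies :: "dgc \<Rightarrow> (nat \<Rightarrow> nat \<Rightarrow> real vec) set" where
  "joint_strategies G = (\<Pi>\<^sub>E i\<in>players G. strategies G i)"

definition joint_action :: "dgc \<Rightarrow> (nat \<Rightarrow> nat \<Rightarrow> real vec) \<Rightarrow> nat \<Rightarrow> real vec" where
  "joint_action G u k = col_stack (map (\<lambda>i. u i k) [1..<Suc (nplayers G)])"

primrec state :: "dgc \<Rightarrow> real vec \<Rightarrow> (nat \<Rightarrow> nat \<Rightarrow> real vec) \<Rightarrow> nat \<Rightarrow> real vec" where
  "state G x0 u 0 = x0"
| "state G x0 u (Suc k) = Amat G k *\<^sub>v state G x0 u k +
     finsum_vec TYPE(real) (sdim G) (\<lambda>i. Bmat G i k *\<^sub>v u i k) (players G)"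

definition cost :: "dgc \<Rightarrow> real vec \<Rightarrow> nat \<Rightarrow> (nat \<Rightarrow> nat \<Rightarrow> real vec) \<Rightarrow> real" where
  "cost G x0 i u = (let x = state G x0 u; K = horizon G in
     1/2 * quad (Qmat G i K) (x K) + pvec G i K \<bullet> x K +
     1/2 * (\<Sum>k\<in>action_stages G. quad (Qmat G i k) (x k) + 2 * (pvec G i k \<bullet> x k) +
              (\<Sum>j\<in>players G. quad (Rmat G i j k) (u j k))))"

definition feasible :: "dgc \<Rightarrow> real vec \<Rightarrow> (nat \<Rightarrow> nat \<Rightarrow> real vec) set" where
  "feasible G x0 = {u \<in> joint_strategies G. \<forall>i\<in>players G. \<forall>k\<in>action_stages G.
     0\<^sub>v (cdim G i) \<le> Mmat G i k *\<^sub>v state G x0 u k + Nmat G i k *\<^sub>v joint_action G u k + rvec G i k}"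

definition Omega :: "dgc \<Rightarrow> (real vec \<times> (nat \<Rightarrow> nat \<Rightarrow> real vec)) set" where
  "Omega G = {(x0, u). x0 \<in> carrier_vec (sdim G) \<and> u \<in> feasible G x0}"

definition initial_states :: "dgc \<Rightarrow> real vec set" where
  "initial_states G = {x0 \<in> carrier_vec (sdim G). feasible G x0 \<noteq> {}}"

text \<open>
  A joint strategy with player \<open>i\<close> deviating to \<open>v\<close> and all others following \<open>u\<close> is \<open>u(i := v)\<close>.
\<close>

definition deviations ::
    "dgc \<Rightarrow> real vec \<Rightarrow> nat \<Rightarrow> (nat \<Rightarrow> nat \<Rightarrow> real vec) \<Rightarrow> (nat \<Rightarrow> real vec) set" where
  "deviations G x0 i u = {v \<in> strategies G i. u(i := v) \<in> feasible G x0}"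

definition GOLNE :: "dgc \<Rightarrow> real vec \<Rightarrow> (nat \<Rightarrow> nat \<Rightarrow> real vec) \<Rightarrow> bool" where
  "GOLNE G x0 u \<longleftrightarrow> u \<in> feasible G x0 \<and>
     (\<forall>i\<in>players G. \<forall>v\<in>deviations G x0 i u. cost G x0 i u \<le> cost G x0 i (u(i := v)))"

section \<open>Assumptions and the linear complementarity system\<close>

text \<open>Boundedness is with respect to the Euclidean norm of the stacked joint strategy.\<close>

definition bounded_joint :: "dgc \<Rightarrow> (nat \<Rightarrow> nat \<Rightarrow> real vec) set \<Rightarrow> bool" where
  "bounded_joint G S \<longleftrightarrow>
     (\<exists>C. \<forall>u\<in>S. sqrt (\<Sum>i\<in>players G. \<Sum>k\<in>action_stages G. u i k \<bullet> u i k) \<le> C)"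

definition assumption1 :: "dgc \<Rightarrow> bool" where
  "assumption1 G \<longleftrightarrow>
     Omega G \<noteq> {} \<and> (\<forall>x0\<in>initial_states G. bounded_joint G (feasible G x0)) \<and>
     (\<forall>i\<in>players G. \<forall>k\<in>action_stages G. full_rank (Nblock G i i k)) \<and>
     (\<forall>i\<in>players G. \<forall>k\<in>action_stages G. positive_definite (Rmat G i i k))"

definition Ymat :: "dgc \<Rightarrow> (nat \<Rightarrow> nat \<Rightarrow> real mat) \<Rightarrow> nat \<Rightarrow> nat \<Rightarrow> real mat" where
  "Ymat G E i k = Rmat G i i k + (Bmat G i k)\<^sup>T * E i (k + 1) * Bmat G i k"

text \<open>
  \<open>E\<close> solves the backward Riccati equations of all players. The recursion determines \<open>E\<close> uniquely
  on the stages, so the matrices \<open>Ymat G E i k\<close> depend on \<open>G\<close> only.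
\<close>

definition riccati_solution :: "dgc \<Rightarrow> (nat \<Rightarrow> nat \<Rightarrow> real mat) \<Rightarrow> bool" where
  "riccati_solution G E \<longleftrightarrow>
     (\<forall>i\<in>players G.
        (\<forall>k\<in>stages G. E i k \<in> carrier_mat (sdim G) (sdim G) \<and> symmetric_matrix (E i k)) \<and>
        E i (horizon G) = Qmat G i (horizon G) \<and>
        (\<forall>k\<in>action_stages G.
           invertible_mat (Ymat G E i k) \<and>
           E i k = (Amat G k)\<^sup>T * E i (k + 1) * Amat G k + Qmat G i k -
             (Amat G k)\<^sup>T * E i (k + 1) * Bmat G i k * matinv (Ymat G E i k) *
               (Bmat G i k)\<^sup>T * E i (k + 1) * Amat G k))"

definition assumption2 :: "dgc \<Rightarrow> bool" where
  "assumption2 G \<longleftrightarrow> (\<exists>E. riccati_solution G E)"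

definition LCS1_solution ::
    "dgc \<Rightarrow> real vec \<Rightarrow> (nat \<Rightarrow> real vec) \<Rightarrow> (nat \<Rightarrow> nat \<Rightarrow> real vec) \<Rightarrow>
     (nat \<Rightarrow> nat \<Rightarrow> real vec) \<Rightarrow> bool" where
  "LCS1_solution G x0 x lam mu \<longleftrightarrow>
     (\<forall>k\<in>stages G. x k \<in> carrier_vec (sdim G)) \<and>
     (\<forall>i\<in>players G. \<forall>k\<in>stages G. lam i k \<in> carrier_vec (sdim G)) \<and>
     (\<forall>i\<in>players G. \<forall>k\<in>action_stages G. mu i k \<in> carrier_vec (cdim G i)) \<and>
     x 0 = x0 \<and>
     (\<forall>i\<in>players G. lam i (horizon G) =
        Qmat G i (horizon G) *\<^sub>v x (horizon G) + pvec G i (horizon G)) \<and>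
     (\<forall>k\<in>action_stages G. x (k + 1) = Amat G k *\<^sub>v x k -
        finsum_vec TYPE(real) (sdim G)
          (\<lambda>j. Bmat G j k *\<^sub>v (matinv (Rmat G j j k) *\<^sub>v
                 ((Bmat G j k)\<^sup>T *\<^sub>v lam j (k + 1) - (Nblock G j j k)\<^sup>T *\<^sub>v mu j k)))
          (players G)) \<and>
     (\<forall>i\<in>players G. \<forall>k\<in>action_stages G.
        lam i k = Qmat G i k *\<^sub>v x k + pvec G i k + (Amat G k)\<^sup>T *\<^sub>v lam i (k + 1)
                  - (Mmat G i k)\<^sup>T *\<^sub>v mu i k \<and>
        complementary
          (Mmat G i k *\<^sub>v x k -
           finsum_vec TYPE(real) (cdim G i)
             (\<lambda>j. Nblock G i j k *\<^sub>v (matinv (Rmat G j j k) *\<^sub>v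
                    ((Bmat G j k)\<^sup>T *\<^sub>v lam j (k + 1) - (Nblock G j j k)\<^sup>T *\<^sub>v mu j k)))
             (players G)
           + rvec G i k)
          (mu i k))"

end

theory Submission
  imports Defs
begin

text \<open>
  Fix a player and a feasible unilateral deviation, and let \<open>d\<close> and \<open>w\<close> be the resulting changes of
  the state and of the action. The cost is quadratic, so its change splits into a first-order and a
  second-order part. By the stationarity and costate equations the first-order part telescopes to
  the sum of the products of the multipliers with the changes of the player's own constraints; by
  complementarity each product equals that of a nonnegative multiplier with the deviated constraint,
  hence is nonnegative. Completing the square with the Riccati solution turns the second-order part
  into a sum of values of the positive definite forms \<open>Y\<close>. Hence no deviation lowers the cost.
\<close>

section \<open>Positive definite matrices and quadratic forms\<close>

lemma positive_definite_right_inverse: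
  assumes pd: "positive_definite A" and A: "A \<in> carrier_mat n n"
  shows "matinv A \<in> carrier_mat n n" and "A * matinv A = 1\<^sub>m n"
proof -
  \<comment> \<open>A nonzero kernel vector would make the form vanish, so \<open>A\<close> is a
    unit of the matrix ring. Only then does \<open>mat_inverse\<close> return \<open>Some\<close>,
    which gives \<open>matinv\<close> its meaning.\<close>
  have "det A \<noteq> 0"
  proof
    assume "det A = 0"
    then obtain v where v: "v \<in> carrier_vec n" "v \<noteq> 0\<^sub>v n" "A *\<^sub>v v = 0\<^sub>v n"
      using det_0_iff_vec_prod_zero_field[OF A] by blast
    have "0 < quad A v"
      using pd A v unfolding positive_definite_def by auto
    with v show False by (simp add: quad_def)
  qed
  then have "A \<in> Units (ring_mat TYPE(real) n ())"
    by (rule det_non_zero_imp_unit[OF A])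
  then obtain C where "mat_inverse A = Some C"
    using mat_inverse(1)[OF A, where b = "()"] by (cases "mat_inverse A") auto
  with mat_inverse(2)[OF A this]
  show "matinv A \<in> carrier_mat n n" and "A * matinv A = 1\<^sub>m n" by auto
qed

lemma positive_definite_quad_nonneg:
  assumes "positive_definite A" and "A \<in> carrier_mat n n" and "v \<in> carrier_vec n"
  shows "0 \<le> quad A v"
proof (cases "v = 0\<^sub>v n")
  case True
  with assms show ?thesis by (simp add: quad_def)
next
  case False
  with assms show ?thesis by (auto simp: positive_definite_def intro: less_imp_le)
qed

lemma symmetric_scalar_prod:
  assumes "symmetric_matrix A" and "A \<in> carrier_mat n n"
    and "a \<in> carrier_vec n" and "b \<in> carrier_vec n"
  shows "a \<bullet> (A *\<^sub>v b) = b \<bullet> (A *\<^sub>v a)"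
proof -
  have "b \<bullet> (A *\<^sub>v a) = (A *\<^sub>v b) \<bullet> a"
    using transpose_vec_mult_scalar[of A n n a b] assms by (simp add: symmetric_matrix_def)
  also have "\<dots> = a \<bullet> (A *\<^sub>v b)"
    using assms by (intro comm_scalar_prod[of _ n]) auto
  finally show ?thesis by simp
qed

lemma quad_add:
  assumes "symmetric_matrix A" and A: "A \<in> carrier_mat n n"
    and a: "a \<in> carrier_vec n" and b: "b \<in> carrier_vec n"
  shows "quad A (a + b) = quad A a + 2 * (b \<bullet> (A *\<^sub>v a)) + quad A b"
  using symmetric_scalar_prod[OF assms] assms(2-)
  by (simp add: quad_def mult_add_distrib_mat_vec[OF A a b] add_scalar_prod_distrib[of _ n]
      scalar_prod_add_distrib[of _ n])

lemma quad_add_mat: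
  assumes "A \<in> carrier_mat n n" and "B \<in> carrier_mat n n" and "a \<in> carrier_vec n"
  shows "quad (A + B) a = quad A a + quad B a"
  using assms by (simp add: quad_def add_mult_distrib_mat_vec[of _ n n] scalar_prod_add_distrib[of _ n])

lemma quad_minus_mat:
  assumes "A \<in> carrier_mat n n" and "B \<in> carrier_mat n n" and "a \<in> carrier_vec n"
  shows "quad (A - B) a = quad A a - quad B a"
  using assms
  by (simp add: quad_def minus_mult_distrib_mat_vec[of _ n n] scalar_prod_minus_distrib[of _ n])

section \<open>Transposes, completion of the square and the one-stage estimate\<close>

lemma scalar_prod_transpose:
  fixes A :: "real mat"
  assumes "A \<in> carrier_mat n m" and "a \<in> carrier_vec m" and "b \<in> carrier_vec n"
  shows "a \<bullet> (A\<^sup>T *\<^sub>v b) = (A *\<^sub>v a) \<bullet> b"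
proof -
  have "a \<bullet> (A\<^sup>T *\<^sub>v b) = (A\<^sup>T *\<^sub>v b) \<bullet> a"
    using assms by (intro comm_scalar_prod[of _ m]) auto
  also have "\<dots> = b \<bullet> (A *\<^sub>v a)"
    by (rule transpose_vec_mult_scalar[OF assms])
  also have "\<dots> = (A *\<^sub>v a) \<bullet> b"
    using assms by (intro comm_scalar_prod[of _ n]) auto
  finally show ?thesis .
qed

text \<open>The side conditions are dimension equations rather than carrier memberships, so long
  products can be unfolded by rewriting without guessing the intermediate dimensions.\<close>

lemma mult_mat_vec_assoc:
  fixes A B :: "real mat"
  assumes "dim_col A = dim_row B" and "dim_col B = dim_vec v"
  shows "(A * B) *\<^sub>v v = A *\<^sub>v (B *\<^sub>v v)"
  using assms by (intro assoc_mult_mat_vec) auto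

text \<open>As a function of \<open>w\<close>, the left side has quadratic part
  \<open>quad Y w\<close> and cross term 2 (w \<bullet> g), where \<open>g\<close> is the image of
  \<open>d\<close> under the transpose of \<open>B\<close> after \<open>E\<close> and
  \<open>A\<close>. Shifting \<open>w\<close> by \<open>h\<close>, the solution of Y h = g, absorbs
  the cross term at the price of g \<bullet> h, which is exactly the value at \<open>d\<close> of
  the form that the Riccati equation subtracts.\<close>

lemma riccati_complete_square:
  assumes A: "A \<in> carrier_mat n n" and B: "B \<in> carrier_mat n m"
    and Q: "Q \<in> carrier_mat n n" and R: "R \<in> carrier_mat m m"
    and E: "E \<in> carrier_mat n n" "symmetric_matrix E"
    and Y: "Y = R + B\<^sup>T * E * B" "symmetric_matrix Y"
    and W: "W \<in> carrier_mat m m" "Y * W = 1\<^sub>m m"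
    and F: "F = A\<^sup>T * E * A + Q - A\<^sup>T * E * B * W * B\<^sup>T * E * A"
    and d: "d \<in> carrier_vec n" and w: "w \<in> carrier_vec m"
  shows "quad E (A *\<^sub>v d + B *\<^sub>v w) + quad Q d + quad R w =
    quad F d + quad Y (w + W *\<^sub>v (B\<^sup>T *\<^sub>v (E *\<^sub>v (A *\<^sub>v d))))"
proof -
  define a where "a = A *\<^sub>v d"
  define b where "b = B *\<^sub>v w"
  define g where "g = B\<^sup>T *\<^sub>v (E *\<^sub>v a)"
  define h where "h = W *\<^sub>v g"
  have a: "a \<in> carrier_vec n" and b: "b \<in> carrier_vec n"
    using A B d w by (auto simp: a_def b_def)
  have g: "g \<in> carrier_vec m" using B E a by (auto simp: g_def)
  have h: "h \<in> carrier_vec m" using W g by (auto simp: h_def)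
  have YC: "Y \<in> carrier_mat m m" using Y R B E by auto
  have Yh: "Y *\<^sub>v h = g"
    using assoc_mult_mat_vec[OF YC W(1) g] W(2) g by (simp add: h_def)
  have wg: "w \<bullet> g = b \<bullet> (E *\<^sub>v a)"
    using scalar_prod_transpose[OF B w, of "E *\<^sub>v a"] E a by (simp add: g_def b_def)
  have quadY: "quad Y w = quad R w + quad E b"
  proof -
    have "quad (B\<^sup>T * E * B) w = w \<bullet> (B\<^sup>T *\<^sub>v (E *\<^sub>v b))"
      using B E w b by (simp add: quad_def b_def mult_mat_vec_assoc del: assoc_mult_mat_vec)
    also have "\<dots> = quad E b"
      using scalar_prod_transpose[OF B w, of "E *\<^sub>v b"] E b by (simp add: quad_def b_def)
    finally show ?thesis
      using Y(1) R B E w by (simp add: quad_add_mat[of _ m])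
  qed
  have quadF: "quad F d = quad E a + quad Q d - g \<bullet> h"
  proof -
    have "quad (A\<^sup>T * E * A) d = d \<bullet> (A\<^sup>T *\<^sub>v (E *\<^sub>v a))"
      using A E d a by (simp add: quad_def a_def mult_mat_vec_assoc del: assoc_mult_mat_vec)
    also have "\<dots> = quad E a"
      using scalar_prod_transpose[OF A d, of "E *\<^sub>v a"] E a by (simp add: quad_def a_def)
    finally have 1: "quad (A\<^sup>T * E * A) d = quad E a" .
    have "A\<^sup>T * E * B * W * B\<^sup>T * E * A *\<^sub>v d = A\<^sup>T *\<^sub>v (E *\<^sub>v (B *\<^sub>v h))"
      using A E B W d a
      by (simp add: h_def g_def a_def mult_mat_vec_assoc del: assoc_mult_mat_vec)
    then have "quad (A\<^sup>T * E * B * W * B\<^sup>T * E * A) d = a \<bullet> (E *\<^sub>v (B *\<^sub>v h))"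
      using scalar_prod_transpose[OF A d, of "E *\<^sub>v (B *\<^sub>v h)"] E B h
      by (simp add: quad_def a_def)
    also have "\<dots> = (B *\<^sub>v h) \<bullet> (E *\<^sub>v a)"
      using E B h a by (intro symmetric_scalar_prod[of _ n]) auto
    also have "\<dots> = h \<bullet> g"
      using scalar_prod_transpose[OF B h, of "E *\<^sub>v a"] E a by (simp add: g_def)
    also have "\<dots> = g \<bullet> h" using g h by (rule comm_scalar_prod[symmetric])
    finally have 2: "quad (A\<^sup>T * E * B * W * B\<^sup>T * E * A) d = g \<bullet> h" .
    have "A\<^sup>T * E * A \<in> carrier_mat n n"
      and "A\<^sup>T * E * B * W * B\<^sup>T * E * A \<in> carrier_mat n n"
      using A B E W(1) by (auto intro!: mult_carrier_mat)
    with 1 2 Q d show ?thesis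
      by (simp only: F quad_minus_mat[of _ n] quad_add_mat[of _ n] add_carrier_mat)
  qed
  \<comment> \<open>Expanding around \<open>h\<close> makes the cross term w \<bullet> (Y h), which
    \<open>Yh\<close> turns into w \<bullet> g.\<close>
  have "quad Y (w + h) = quad Y (h + w)" using w h by (simp add: comm_add_vec[of _ m])
  also have "\<dots> = h \<bullet> g + 2 * (w \<bullet> g) + quad Y w"
    using quad_add[OF Y(2) YC h w] Yh by (simp add: quad_def)
  also have "h \<bullet> g = g \<bullet> h" using h g by (rule comm_scalar_prod)
  finally have "quad E (a + b) + quad Q d + quad R w = quad F d + quad Y (w + h)"
    using quad_add[OF E(2,1) a b] wg quadY quadF by linarith
  then show ?thesis by (simp only: a_def b_def g_def h_def)
qed

text \<open>
  Here \<open>d\<close> and \<open>w\<close> are the deviations of the state and of the action, and primes mark the next stage.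
\<close>

lemma stage_cost_increment:
  assumes A: "A \<in> carrier_mat n n" and B: "B \<in> carrier_mat n m"
    and M: "M \<in> carrier_mat c n" and N: "N \<in> carrier_mat c m"
    and Q: "Q \<in> carrier_mat n n" "symmetric_matrix Q"
    and R: "R \<in> carrier_mat m m" "symmetric_matrix R"
    and E: "E \<in> carrier_mat n n" "symmetric_matrix E"
    and Y: "Y = R + B\<^sup>T * E * B" "positive_definite Y"
    and F: "F = A\<^sup>T * E * A + Q - A\<^sup>T * E * B * matinv Y * B\<^sup>T * E * A"
    and x: "x \<in> carrier_vec n" and d: "d \<in> carrier_vec n" and p: "p \<in> carrier_vec n"
    and u: "u \<in> carrier_vec m" and w: "w \<in> carrier_vec m"
    and l': "l' \<in> carrier_vec n" and mu: "mu \<in> carrier_vec c"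
    and costate: "l = Q *\<^sub>v x + p + A\<^sup>T *\<^sub>v l' - M\<^sup>T *\<^sub>v mu"
    and stationary: "R *\<^sub>v u = - (B\<^sup>T *\<^sub>v l' - N\<^sup>T *\<^sub>v mu)"
    and multiplier: "0 \<le> mu \<bullet> (M *\<^sub>v d + N *\<^sub>v w)"
    and d': "d' = A *\<^sub>v d + B *\<^sub>v w"
  shows "quad Q x + 2 * (p \<bullet> x) + quad R u + (2 * (l \<bullet> d) + quad F d) - (2 * (l' \<bullet> d') + quad E d')
    \<le> quad Q (x + d) + 2 * (p \<bullet> (x + d)) + quad R (u + w)"
proof -
  have YC: "Y \<in> carrier_mat m m" using Y R B E by auto
  have Ysym: "symmetric_matrix Y" using Y(2) by (simp add: positive_definite_def)
  note W = positive_definite_right_inverse[OF Y(2) YC]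
  have "0 \<le> quad Y (w + matinv Y *\<^sub>v (B\<^sup>T *\<^sub>v (E *\<^sub>v (A *\<^sub>v d))))"
    using Y(2) YC W A B E d w by (intro positive_definite_quad_nonneg) auto
  \<comment> \<open>Positive definiteness of \<open>Y\<close> lets the completed square be dropped,
    so the second-order part is bounded below by a difference of Riccati forms.\<close>
  then have square: "quad F d \<le> quad E d' + quad Q d + quad R w"
    using riccati_complete_square[OF A B Q(1) R(1) E Y(1) Ysym W F d w] d' by simp
  \<comment> \<open>Pairing the costate equation with \<open>d\<close> and stationarity with
    \<open>w\<close> applies \<open>l'\<close> to A d and to B w. These two values add up to d'
    \<bullet> l', and only the multiplier terms remain.\<close>
  have ld: "d \<bullet> l = d \<bullet> (Q *\<^sub>v x) + d \<bullet> p + (A *\<^sub>v d) \<bullet> l' - (M *\<^sub>v d) \<bullet> mu"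
    using A M Q x d p l' mu
    by (simp add: costate scalar_prod_minus_distrib[of _ n] scalar_prod_add_distrib[of _ n]
        scalar_prod_transpose[of _ n n] scalar_prod_transpose[of _ c n])
  have wR: "w \<bullet> (R *\<^sub>v u) = (N *\<^sub>v w) \<bullet> mu - (B *\<^sub>v w) \<bullet> l'"
    using B N w l' mu
    by (simp add: stationary scalar_prod_minus_distrib[of _ m]
        scalar_prod_transpose[of _ n m] scalar_prod_transpose[of _ c m])
  have ld': "d' \<bullet> l' = (A *\<^sub>v d) \<bullet> l' + (B *\<^sub>v w) \<bullet> l'"
    using A B d w l' by (simp add: d' add_scalar_prod_distrib[of _ n])
  have "mu \<bullet> (M *\<^sub>v d + N *\<^sub>v w) = (M *\<^sub>v d + N *\<^sub>v w) \<bullet> mu"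
    using M N d w mu by (intro comm_scalar_prod[of _ c]) auto
  also have "\<dots> = (M *\<^sub>v d) \<bullet> mu + (N *\<^sub>v w) \<bullet> mu"
    using M N d w mu by (intro add_scalar_prod_distrib[of _ c]) auto
  finally have mult: "0 \<le> (M *\<^sub>v d) \<bullet> mu + (N *\<^sub>v w) \<bullet> mu" using multiplier by simp
  have lC: "l \<in> carrier_vec n" using costate A M Q x p l' mu by auto
  have d'C: "d' \<in> carrier_vec n" using d' A B d w by auto
  have comm: "l \<bullet> d = d \<bullet> l" "l' \<bullet> d' = d' \<bullet> l'" "p \<bullet> d = d \<bullet> p"
    using lC d d'C l' p by (auto intro: comm_scalar_prod[of _ n])
  \<comment> \<open>Right side minus left side is twice the multiplier term of \<open>mult\<close>
    plus the slack in \<open>square\<close>.\<close>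
  show ?thesis
    using quad_add[OF Q(2,1) x d] quad_add[OF R(2,1) u w] square ld wR ld' mult comm
      scalar_prod_add_distrib[OF p x d]
    by simp
qed

section \<open>Stacked joint actions and column blocks\<close>

lemma append_vec_assoc: "(a @\<^sub>v b) @\<^sub>v c = a @\<^sub>v b @\<^sub>v c"
  by (intro eq_vecI) auto

lemma append_vec_vNil_right: "a @\<^sub>v vNil = a"
  by (intro eq_vecI) auto

text \<open>\<open>col_stack\<close> recurses on the first block, whereas induction on the number of
  players adds a last one.\<close>

lemma col_stack_snoc: "col_stack (vs @ [v]) = col_stack vs @\<^sub>v v"
  by (induction vs) (simp_all add: col_stack_def append_vec_assoc append_vec_vNil_right)

lemma sum_lessThan_add:
  fixes g :: "nat \<Rightarrow> real"
  shows "(\<Sum>l<s + t. g l) = (\<Sum>l<s. g l) + (\<Sum>b<t. g (s + b))"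
  by (induction t) auto

text \<open>Block \<open>j\<close> starts at the total length of its predecessors, so a weighted sum
  over the stacked vector splits by blocks. The weights \<open>f\<close> stand for one row of a
  matrix acting on that vector.\<close>

lemma col_stack_blocks:
  assumes "\<And>j. j \<in> {1..n} \<Longrightarrow> dim_vec (v j) = m j"
  shows "dim_vec (col_stack (map v [1..<Suc n])) = (\<Sum>j\<in>{1..n}. m j)"
    and "(\<Sum>l<(\<Sum>j\<in>{1..n}. m j). f l * col_stack (map v [1..<Suc n]) $ l) =
      (\<Sum>j\<in>{1..n}. \<Sum>b<m j. f ((\<Sum>l\<in>{1..<j}. m l) + b) * v j $ b)"
proof -
  \<comment> \<open>Both claims share one induction: locating the entries of the appended block
    requires the length of the prefix.\<close>
  have "dim_vec (col_stack (map v [1..<Suc n])) = (\<Sum>j\<in>{1..n}. m j) \<and>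
    (\<Sum>l<(\<Sum>j\<in>{1..n}. m j). f l * col_stack (map v [1..<Suc n]) $ l) =
      (\<Sum>j\<in>{1..n}. \<Sum>b<m j. f ((\<Sum>l\<in>{1..<j}. m l) + b) * v j $ b)"
    using assms
  proof (induction n)
    case 0
    then show ?case by (simp add: col_stack_def)
  next
    case (Suc n)
    let ?c = "col_stack (map v [1..<Suc n])"
    let ?s = "\<Sum>j\<in>{1..n}. m j"
    have IH: "dim_vec ?c = ?s"
      "(\<Sum>l<?s. f l * ?c $ l) = (\<Sum>j\<in>{1..n}. \<Sum>b<m j. f ((\<Sum>l\<in>{1..<j}. m l) + b) * v j $ b)"
      using Suc by auto
    have dv: "dim_vec (v (Suc n)) = m (Suc n)" using Suc.prems by simp
    have c: "col_stack (map v [1..<Suc (Suc n)]) = ?c @\<^sub>v v (Suc n)"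
      using col_stack_snoc[of "map v [1..<Suc n]" "v (Suc n)"] by simp
    have "(\<Sum>l<?s + m (Suc n). f l * (?c @\<^sub>v v (Suc n)) $ l) =
      (\<Sum>l<?s. f l * (?c @\<^sub>v v (Suc n)) $ l) +
      (\<Sum>b<m (Suc n). f (?s + b) * (?c @\<^sub>v v (Suc n)) $ (?s + b))"
      by (rule sum_lessThan_add)
    also have "\<dots> = (\<Sum>l<?s. f l * ?c $ l) + (\<Sum>b<m (Suc n). f (?s + b) * v (Suc n) $ b)"
      using IH(1) dv by (intro arg_cong2[where f = "(+)"] sum.cong) auto
    finally show ?case
      unfolding c using IH dv by (simp add: atLeastLessThanSuc_atLeastAtMost del: upt_Suc)
  qed
  then show "dim_vec (col_stack (map v [1..<Suc n])) = (\<Sum>j\<in>{1..n}. m j)"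
    and "(\<Sum>l<(\<Sum>j\<in>{1..n}. m j). f l * col_stack (map v [1..<Suc n]) $ l) =
      (\<Sum>j\<in>{1..n}. \<Sum>b<m j. f ((\<Sum>l\<in>{1..<j}. m l) + b) * v j $ b)" by auto
qed

lemma action_stages_eq: "action_stages G = {..<horizon G}"
  by (auto simp: action_stages_def stages_def)

text \<open>This links the constraints of the game, written with the full matrix, to LCS1, written
  block by block. The column offset in \<open>Nblock\<close> is the position of the block in the
  stacked action.\<close>

lemma Nmat_joint_action:
  assumes N: "Nmat G i k \<in> carrier_mat (cdim G i) (total_adim G)"
    and u: "\<And>j. j \<in> players G \<Longrightarrow> u j k \<in> carrier_vec (adim G j)"
  shows "Nmat G i k *\<^sub>v joint_action G u k =
    finsum_vec TYPE(real) (cdim G i) (\<lambda>j. Nblock G i j k *\<^sub>v u j k) (players G)"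
proof (intro eq_vecI)
  have carr: "(\<lambda>j. Nblock G i j k *\<^sub>v u j k) \<in> players G \<rightarrow> carrier_vec (cdim G i)"
    using u by (auto simp: Nblock_def intro!: mult_mat_vec_carrier)
  then have fC: "finsum_vec TYPE(real) (cdim G i) (\<lambda>j. Nblock G i j k *\<^sub>v u j k) (players G)
      \<in> carrier_vec (cdim G i)"
    by (rule finsum_vec_closed)
  then show "dim_vec (Nmat G i k *\<^sub>v joint_action G u k) =
      dim_vec (finsum_vec TYPE(real) (cdim G i) (\<lambda>j. Nblock G i j k *\<^sub>v u j k) (players G))"
    using N by simp
  fix a
  assume "a < dim_vec (finsum_vec TYPE(real) (cdim G i) (\<lambda>j. Nblock G i j k *\<^sub>v u j k) (players G))"
  then have a: "a < cdim G i" using fC by simp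
  have dims: "\<And>j. j \<in> {1..nplayers G} \<Longrightarrow> dim_vec (u j k) = adim G j"
    using u by (auto simp: players_def)
  have dja: "dim_vec (joint_action G u k) = total_adim G"
    using col_stack_blocks(1)[OF dims]
    by (simp add: joint_action_def total_adim_def players_def del: upt_Suc)
  have "(Nmat G i k *\<^sub>v joint_action G u k) $ a =
      (\<Sum>l<total_adim G. Nmat G i k $$ (a, l) * joint_action G u k $ l)"
    using N a dja by (simp add: scalar_prod_def atLeast0LessThan)
  also have "\<dots> = (\<Sum>j\<in>players G. \<Sum>b<adim G j.
      Nmat G i k $$ (a, (\<Sum>l\<in>{1..<j}. adim G l) + b) * u j k $ b)"
    using col_stack_blocks(2)[OF dims, where f = "\<lambda>l. Nmat G i k $$ (a, l)"]
    by (simp add: joint_action_def total_adim_def players_def del: upt_Suc)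
  also have "\<dots> = (\<Sum>j\<in>players G. (Nblock G i j k *\<^sub>v u j k) $ a)"
    using a dims by (intro sum.cong refl)
      (simp add: Nblock_def scalar_prod_def atLeast0LessThan players_def)
  also have "\<dots> = finsum_vec TYPE(real) (cdim G i) (\<lambda>j. Nblock G i j k *\<^sub>v u j k) (players G) $ a"
    using a carr by (intro index_finsum_vec[symmetric]) (auto simp: players_def)
  finally show "(Nmat G i k *\<^sub>v joint_action G u k) $ a = \<dots>" .
qed

section \<open>Finite sums of vectors\<close>

lemma finsum_vec_change_one:
  fixes f :: "'a \<Rightarrow> real vec"
  assumes "finite F" and i: "i \<in> F"
    and f: "f \<in> F \<rightarrow> carrier_vec n" and g: "g \<in> F \<rightarrow> carrier_vec n"
    and eq: "\<And>j. j \<in> F \<Longrightarrow> j \<noteq> i \<Longrightarrow> g j = f j"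
  shows "finsum_vec TYPE(real) n g F = finsum_vec TYPE(real) n f F + (g i - f i)"
proof (intro eq_vecI)
  note gC = finsum_vec_closed[OF g]
  have gi: "g i \<in> carrier_vec n" "f i \<in> carrier_vec n" using f g i by auto
  then show "dim_vec (finsum_vec TYPE(real) n g F) =
      dim_vec (finsum_vec TYPE(real) n f F + (g i - f i))"
    using gC by simp
  fix a assume "a < dim_vec (finsum_vec TYPE(real) n f F + (g i - f i))"
  then have a: "a < n" using gi by simp
  have "(\<Sum>j\<in>F. g j $ a) = (\<Sum>j\<in>F. f j $ a) + (g i $ a - f i $ a)"
    using eq by (simp add: sum.remove[OF assms(1) i])
  then show "finsum_vec TYPE(real) n g F $ a = (finsum_vec TYPE(real) n f F + (g i - f i)) $ a"
    using a gi f g assms(1) by (simp add: index_finsum_vec)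
qed

text \<open>Reconciles the minus sign inside the candidate actions with the one that LCS1 puts in
  front of its sums.\<close>

lemma finsum_vec_uminus:
  fixes f :: "'a \<Rightarrow> real vec"
  assumes "finite F" and f: "f \<in> F \<rightarrow> carrier_vec n" and g: "\<And>j. j \<in> F \<Longrightarrow> g j = - f j"
  shows "finsum_vec TYPE(real) n g F = - finsum_vec TYPE(real) n f F"
proof (intro eq_vecI)
  have g': "g \<in> F \<rightarrow> carrier_vec n" using f g by auto
  note fC = finsum_vec_closed[OF f] and gC = finsum_vec_closed[OF g']
  show "dim_vec (finsum_vec TYPE(real) n g F) = dim_vec (- finsum_vec TYPE(real) n f F)"
    using fC gC by simp
  fix a assume "a < dim_vec (- finsum_vec TYPE(real) n f F)"
  then have a: "a < n" using fC by simp
  have "(\<Sum>j\<in>F. g j $ a) = (\<Sum>j\<in>F. - (f j $ a))"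
    using a f g by (intro sum.cong refl) (metis carrier_vecD funcset_mem index_uminus_vec(1))
  then show "finsum_vec TYPE(real) n g F $ a = (- finsum_vec TYPE(real) n f F) $ a"
    using a f g' fC assms(1) by (simp add: index_finsum_vec sum_negf)
qed

lemma uminus_mult_mat_vec:
  fixes A :: "real mat"
  assumes "A \<in> carrier_mat n m" and "a \<in> carrier_vec m"
  shows "A *\<^sub>v (- a) = - (A *\<^sub>v a)"
  using assms by (intro eq_vecI) auto

lemma scalar_prod_nonneg:
  fixes a b :: "real vec"
  assumes "0\<^sub>v n \<le> a" and "0\<^sub>v n \<le> b"
  shows "0 \<le> a \<bullet> b"
  using assms unfolding scalar_prod_def less_eq_vec_def by (auto intro!: sum_nonneg)

section \<open>State trajectories and constraints under a unilateral deviation\<close>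

lemma strategies_carrier:
  assumes "u \<in> joint_strategies G" and "j \<in> players G" and "k < horizon G"
  shows "u j k \<in> carrier_vec (adim G j)"
  using assms by (auto simp: joint_strategies_def strategies_def action_stages_eq)

lemma state_carrier:
  assumes G: "is_dgc G" and x0: "x0 \<in> carrier_vec (sdim G)"
    and u: "u \<in> joint_strategies G" and k: "k \<le> horizon G"
  shows "state G x0 u k \<in> carrier_vec (sdim G)"
  using k
proof (induction k)
  case 0
  with x0 show ?case by simp
next
  case (Suc k)
  have "Bmat G i k *\<^sub>v u i k \<in> carrier_vec (sdim G)" if "i \<in> players G" for i
    using G strategies_carrier[OF u that] Suc.prems that
    by (intro mult_mat_vec_carrier[of _ _ "adim G i"]) (auto simp: is_dgc_def action_stages_eq)
  then have "(\<lambda>i. Bmat G i k *\<^sub>v u i k) \<in> players G \<rightarrow> carrier_vec (sdim G)"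
    by auto
  from finsum_vec_closed[OF this] Suc show ?case
    using G by (auto simp: is_dgc_def action_stages_eq intro!: mult_mat_vec_carrier add_carrier_vec)
qed

text \<open>In open loop the other players' actions do not react to the changed state, so they
  cancel. By linearity the state difference is driven by the deviator's action change alone.\<close>

lemma state_deviation:
  assumes G: "is_dgc G" and x0: "x0 \<in> carrier_vec (sdim G)" and i: "i \<in> players G"
    and u: "u \<in> joint_strategies G" and u': "u(i := v) \<in> joint_strategies G"
    and k: "k < horizon G"
  shows "state G x0 (u(i := v)) (Suc k) - state G x0 u (Suc k) =
    Amat G k *\<^sub>v (state G x0 (u(i := v)) k - state G x0 u k) + Bmat G i k *\<^sub>v (v k - u i k)"
proof -
  let ?y = "state G x0 (u(i := v)) k" and ?x = "state G x0 u k"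
  let ?f = "\<lambda>j. Bmat G j k *\<^sub>v u j k" and ?g = "\<lambda>j. Bmat G j k *\<^sub>v (u(i := v)) j k"
  let ?S = "\<lambda>f. finsum_vec TYPE(real) (sdim G) f (players G)"
  have A: "Amat G k \<in> carrier_mat (sdim G) (sdim G)"
    and B: "\<And>j. j \<in> players G \<Longrightarrow> Bmat G j k \<in> carrier_mat (sdim G) (adim G j)"
    using G k by (auto simp: is_dgc_def action_stages_eq)
  have y: "?y \<in> carrier_vec (sdim G)" and x: "?x \<in> carrier_vec (sdim G)"
    using state_carrier[OF G x0 u'] state_carrier[OF G x0 u] k by simp_all
  have uk: "u i k \<in> carrier_vec (adim G i)" and vk: "v k \<in> carrier_vec (adim G i)"
    using strategies_carrier[OF u i k] strategies_carrier[OF u' i k] by auto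
  have f: "?f \<in> players G \<rightarrow> carrier_vec (sdim G)" and g: "?g \<in> players G \<rightarrow> carrier_vec (sdim G)"
    using strategies_carrier[OF u _ k] strategies_carrier[OF u' _ k] B
    by (auto intro: mult_mat_vec_carrier simp del: fun_upd_apply)
  have "?S ?g = ?S ?f + (?g i - ?f i)"
    using i f g by (intro finsum_vec_change_one) (auto simp: players_def)
  moreover have "?S ?f \<in> carrier_vec (sdim G)" by (rule finsum_vec_closed[OF f])
  ultimately show ?thesis
    using A B[OF i] x y uk vk
    by (auto simp: mult_minus_distrib_mat_vec[OF A y x] mult_minus_distrib_mat_vec[OF B[OF i] vk uk])
qed

text \<open>The constraint is affine and only the deviator's action changes, so its increment
  involves just the state difference and the deviator's own column block.\<close>

lemma constraint_deviation:
  assumes G: "is_dgc G" and x0: "x0 \<in> carrier_vec (sdim G)" and i: "i \<in> players G"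
    and u: "u \<in> joint_strategies G" and u': "u(i := v) \<in> joint_strategies G"
    and k: "k < horizon G"
  shows "Mmat G i k *\<^sub>v state G x0 (u(i := v)) k + Nmat G i k *\<^sub>v joint_action G (u(i := v)) k + rvec G i k
    = (Mmat G i k *\<^sub>v state G x0 u k + Nmat G i k *\<^sub>v joint_action G u k + rvec G i k) +
      (Mmat G i k *\<^sub>v (state G x0 (u(i := v)) k - state G x0 u k) + Nblock G i i k *\<^sub>v (v k - u i k))"
proof -
  let ?y = "state G x0 (u(i := v)) k" and ?x = "state G x0 u k"
  let ?f = "\<lambda>j. Nblock G i j k *\<^sub>v u j k" and ?g = "\<lambda>j. Nblock G i j k *\<^sub>v (u(i := v)) j k"
  let ?S = "\<lambda>f. finsum_vec TYPE(real) (cdim G i) f (players G)"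
  have M: "Mmat G i k \<in> carrier_mat (cdim G i) (sdim G)"
    and N: "Nmat G i k \<in> carrier_mat (cdim G i) (total_adim G)"
    and r: "rvec G i k \<in> carrier_vec (cdim G i)"
    using G i k by (auto simp: is_dgc_def action_stages_eq)
  have B: "\<And>j. Nblock G i j k \<in> carrier_mat (cdim G i) (adim G j)"
    by (simp add: Nblock_def)
  have y: "?y \<in> carrier_vec (sdim G)" and x: "?x \<in> carrier_vec (sdim G)"
    using state_carrier[OF G x0 u'] state_carrier[OF G x0 u] k by simp_all
  have uk: "u i k \<in> carrier_vec (adim G i)" and vk: "v k \<in> carrier_vec (adim G i)"
    using strategies_carrier[OF u i k] strategies_carrier[OF u' i k] by auto
  have f: "?f \<in> players G \<rightarrow> carrier_vec (cdim G i)" and g: "?g \<in> players G \<rightarrow> carrier_vec (cdim G i)"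
    using strategies_carrier[OF u _ k] strategies_carrier[OF u' _ k] B
    by (auto intro: mult_mat_vec_carrier simp del: fun_upd_apply)
  have "?S ?g = ?S ?f + (?g i - ?f i)"
    using i f g by (intro finsum_vec_change_one) (auto simp: players_def)
  moreover have "?S ?f \<in> carrier_vec (cdim G i)" by (rule finsum_vec_closed[OF f])
  moreover have "Nmat G i k *\<^sub>v joint_action G u k = ?S ?f"
    by (rule Nmat_joint_action[OF N]) (rule strategies_carrier[OF u _ k])
  moreover have "Nmat G i k *\<^sub>v joint_action G (u(i := v)) k = ?S ?g"
    by (rule Nmat_joint_action[OF N]) (rule strategies_carrier[OF u' _ k])
  ultimately show ?thesis
    using M r B[of i] x y uk vk
    by (auto simp: mult_minus_distrib_mat_vec[OF M y x] mult_minus_distrib_mat_vec[OF B vk uk])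
qed

section \<open>From a solution of LCS1 to an equilibrium\<close>

theorem theorem4:
  fixes G :: dgc
    and x0 :: "real vec"
    and x :: "nat \<Rightarrow> real vec"
    and lam mu :: "nat \<Rightarrow> nat \<Rightarrow> real vec"
  assumes "is_dgc G"
    and "assumption1 G"
    and "assumption2 G"
    and "x0 \<in> initial_states G"
    and "\<And>E i k. riccati_solution G E \<Longrightarrow> i \<in> players G \<Longrightarrow> k \<in> action_stages G \<Longrightarrow>
           positive_definite (Ymat G E i k)"
    and "LCS1_solution G x0 x lam mu"
  shows "GOLNE G x0
           (\<lambda>i\<in>players G. \<lambda>k\<in>action_stages G.
              - (matinv (Rmat G i i k) *\<^sub>v
                   ((Bmat G i k)\<^sup>T *\<^sub>v lam i (k + 1) - (Nblock G i i k)\<^sup>T *\<^sub>v mu i k)))"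
proof -
  define g where "g i k = (Bmat G i k)\<^sup>T *\<^sub>v lam i (k + 1) - (Nblock G i i k)\<^sup>T *\<^sub>v mu i k" for i k
  define u where "u = (\<lambda>i\<in>players G. \<lambda>k\<in>action_stages G. - (matinv (Rmat G i i k) *\<^sub>v g i k))"
  let ?n = "sdim G" and ?K = "horizon G"
  note G = assms(1)
  have A: "Amat G k \<in> carrier_mat ?n ?n" if "k < ?K" for k
    using G that by (auto simp: is_dgc_def action_stages_eq)
  have B: "Bmat G i k \<in> carrier_mat ?n (adim G i)"
    and M: "Mmat G i k \<in> carrier_mat (cdim G i) ?n"
    and N: "Nmat G i k \<in> carrier_mat (cdim G i) (total_adim G)"
    and r: "rvec G i k \<in> carrier_vec (cdim G i)"
    and R: "Rmat G i i k \<in> carrier_mat (adim G i) (adim G i)" "symmetric_matrix (Rmat G i i k)"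
    if "i \<in> players G" "k < ?K" for i k
    using G that by (auto simp: is_dgc_def action_stages_eq)
  have Q: "Qmat G i k \<in> carrier_mat ?n ?n" "symmetric_matrix (Qmat G i k)"
    and p: "pvec G i k \<in> carrier_vec ?n"
    if "i \<in> players G" "k \<le> ?K" for i k
    using G that by (auto simp: is_dgc_def stages_def)
  have NB: "Nblock G i j k \<in> carrier_mat (cdim G i) (adim G j)" for i j k
    by (simp add: Nblock_def)
  have Rinv: "matinv (Rmat G i i k) \<in> carrier_mat (adim G i) (adim G i)"
    "Rmat G i i k * matinv (Rmat G i i k) = 1\<^sub>m (adim G i)"
    if "i \<in> players G" "k < ?K" for i k
    using assms(2) that positive_definite_right_inverse[OF _ R(1)[OF that]]
    by (auto simp: assumption1_def action_stages_eq)
  have x0: "x0 \<in> carrier_vec ?n" using assms(4) by (simp add: initial_states_def)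
  note lcs = assms(6)[unfolded LCS1_solution_def, folded g_def]
  have lam: "lam i k \<in> carrier_vec ?n" if "i \<in> players G" "k \<le> ?K" for i k
    using lcs that by (auto simp: stages_def)
  have mu: "mu i k \<in> carrier_vec (cdim G i)" if "i \<in> players G" "k < ?K" for i k
    using lcs that by (auto simp: action_stages_eq)
  have g: "g i k \<in> carrier_vec (adim G i)" if "i \<in> players G" "k < ?K" for i k
    using B[OF that] NB[of i i k] lam[of i "k + 1"] mu[OF that] that by (simp add: g_def)
  have h: "matinv (Rmat G i i k) *\<^sub>v g i k \<in> carrier_vec (adim G i)"
    if "i \<in> players G" "k < ?K" for i k
    using Rinv(1)[OF that] g[OF that] by simp
  have u_eq: "u i k = - (matinv (Rmat G i i k) *\<^sub>v g i k)" if "i \<in> players G" "k < ?K" for i k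
    using that by (simp add: u_def action_stages_eq)
  have u: "u \<in> joint_strategies G"
    using h by (auto simp: u_def joint_strategies_def strategies_def action_stages_eq)
  note uC = strategies_carrier[OF u]
  \<comment> \<open>First-order condition of each player in the own action: R u plus the costate
    term minus the multiplier term vanishes.\<close>
  have stationary: "Rmat G i i k *\<^sub>v u i k = - g i k" if "i \<in> players G" "k < ?K" for i k
  proof -
    have "Rmat G i i k *\<^sub>v (matinv (Rmat G i i k) *\<^sub>v g i k) = g i k"
      using assoc_mult_mat_vec[OF R(1)[OF that] Rinv(1)[OF that] g[OF that]] Rinv(2)[OF that] g[OF that]
      by simp
    then show ?thesis
      using uminus_mult_mat_vec[OF R(1)[OF that] h[OF that]] by (simp add: u_eq[OF that])
  qed
  \<comment> \<open>The LCS1 recursion is the game dynamics with the candidate actions substituted,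
    so \<open>x\<close> is the trajectory generated by \<open>u\<close>.\<close>
  have state: "state G x0 u k = x k" if "k \<le> ?K" for k
    using that
  proof (induction k)
    case 0
    show ?case using lcs by simp
  next
    case (Suc k)
    let ?f = "\<lambda>j. Bmat G j k *\<^sub>v (matinv (Rmat G j j k) *\<^sub>v g j k)"
    let ?S = "\<lambda>f. finsum_vec TYPE(real) ?n f (players G)"
    have k: "k < ?K" using Suc.prems by simp
    have f: "?f \<in> players G \<rightarrow> carrier_vec ?n"
      using mult_mat_vec_carrier[OF B h] k by auto
    have "?S (\<lambda>j. Bmat G j k *\<^sub>v u j k) = - ?S ?f"
      using f k by (intro finsum_vec_uminus)
        (auto simp: u_eq uminus_mult_mat_vec[OF B h] players_def)
    moreover have "x (Suc k) = Amat G k *\<^sub>v x k - ?S ?f"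
      using lcs k by (simp add: action_stages_eq)
    moreover have "x k \<in> carrier_vec ?n" using lcs k by (simp add: stages_def)
    ultimately show ?case
      using Suc A[OF k] finsum_vec_closed[OF f] by (auto simp: minus_add_uminus_vec[of _ ?n])
  qed
  define c where "c i k = Mmat G i k *\<^sub>v state G x0 u k + Nmat G i k *\<^sub>v joint_action G u k + rvec G i k"
    for i k
  \<comment> \<open>Once the joint action is split into blocks, the slack in LCS1 is the constraint
    value \<open>c\<close> along \<open>u\<close>. Feasibility of \<open>u\<close> and orthogonality
    to \<open>mu\<close> both follow from this.\<close>
  have compl: "complementary (c i k) (mu i k)" and cC: "c i k \<in> carrier_vec (cdim G i)"
    if i: "i \<in> players G" and k: "k < ?K" for i k
  proof -
    let ?f = "\<lambda>j. Nblock G i j k *\<^sub>v (matinv (Rmat G j j k) *\<^sub>v g j k)"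
    let ?S = "\<lambda>f. finsum_vec TYPE(real) (cdim G i) f (players G)"
    have f: "?f \<in> players G \<rightarrow> carrier_vec (cdim G i)"
      using mult_mat_vec_carrier[OF NB h] k by auto
    have "Nmat G i k *\<^sub>v joint_action G u k = ?S (\<lambda>j. Nblock G i j k *\<^sub>v u j k)"
      by (rule Nmat_joint_action[OF N[OF i k]]) (rule uC[OF _ k])
    also have "\<dots> = - ?S ?f"
      using f k by (intro finsum_vec_uminus)
        (auto simp: u_eq uminus_mult_mat_vec[OF NB h] players_def)
    finally have Nu: "Nmat G i k *\<^sub>v joint_action G u k = - ?S ?f" .
    have xk: "x k \<in> carrier_vec ?n" using lcs k by (simp add: stages_def)
    have c: "c i k = Mmat G i k *\<^sub>v x k - ?S ?f + rvec G i k"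
      using state[of k] k M[OF i k] xk finsum_vec_closed[OF f]
      by (simp add: c_def Nu minus_add_uminus_vec[of _ "cdim G i"])
    show "c i k \<in> carrier_vec (cdim G i)"
      using r[OF i k] by (intro carrier_vecI) (simp add: c_def)
    show "complementary (c i k) (mu i k)"
      using lcs i k by (simp add: c action_stages_eq)
  qed
  have feasible: "u \<in> feasible G x0"
    unfolding feasible_def
  proof (intro CollectI conjI ballI u)
    fix i k assume "i \<in> players G" and "k \<in> action_stages G"
    then have "complementary (c i k) (mu i k)" and "c i k \<in> carrier_vec (cdim G i)"
      using compl cC by (auto simp: action_stages_eq)
    then show "0\<^sub>v (cdim G i) \<le>
        Mmat G i k *\<^sub>v state G x0 u k + Nmat G i k *\<^sub>v joint_action G u k + rvec G i k"
      unfolding complementary_def c_def[symmetric] by (metis carrier_vecD)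
  qed
  obtain E where E: "riccati_solution G E" using assms(3) by (auto simp: assumption2_def)
  have "cost G x0 i u \<le> cost G x0 i (u(i := v))"
    if i: "i \<in> players G" and v: "v \<in> deviations G x0 i u" for i v
  proof -
    let ?u = "u(i := v)"
    have feas': "?u \<in> feasible G x0" using v by (simp add: deviations_def)
    then have u': "?u \<in> joint_strategies G" by (simp add: feasible_def)
    define d where "d k = state G x0 ?u k - state G x0 u k" for k
    define w where "w k = v k - u i k" for k
    have xC: "x k \<in> carrier_vec ?n" if "k \<le> ?K" for k
      using lcs that by (simp add: stages_def)
    have yC: "state G x0 ?u k \<in> carrier_vec ?n" if "k \<le> ?K" for k
      using state_carrier[OF G x0 u' that] .
    have dC: "d k \<in> carrier_vec ?n" if "k \<le> ?K" for k
      using yC[OF that] xC[OF that] state[OF that] by (simp add: d_def)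
    have y: "state G x0 ?u k = x k + d k" if "k \<le> ?K" for k
      using yC[OF that] xC[OF that] state[OF that] by (auto simp: d_def)
    have vC: "v k \<in> carrier_vec (adim G i)" if "k < ?K" for k
      using strategies_carrier[OF u' i that] by simp
    have wC: "w k \<in> carrier_vec (adim G i)" if "k < ?K" for k
      using vC[OF that] uC[OF i that] by (simp add: w_def)
    have v_eq: "v k = u i k + w k" if "k < ?K" for k
      using vC[OF that] uC[OF i that] by (auto simp: w_def)
    have d0: "d 0 = 0\<^sub>v ?n" using x0 by (simp add: d_def)
    have dSuc: "d (Suc k) = Amat G k *\<^sub>v d k + Bmat G i k *\<^sub>v w k" if "k < ?K" for k
      unfolding d_def w_def by (rule state_deviation[OF G x0 i u u' that])
    \<comment> \<open>Since \<open>mu\<close> is orthogonal to \<open>c\<close>, adding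
      \<open>c\<close> to the increment does not change the product; the sum is the deviated
      constraint, which is nonnegative.\<close>
    have multiplier: "0 \<le> mu i k \<bullet> (Mmat G i k *\<^sub>v d k + Nblock G i i k *\<^sub>v w k)" if k: "k < ?K" for k
    proof -
      let ?z = "Mmat G i k *\<^sub>v d k + Nblock G i i k *\<^sub>v w k"
      have zC: "?z \<in> carrier_vec (cdim G i)"
        using M[OF i k] NB[of i i k] dC[of k] wC[OF k] k by simp
      have "0\<^sub>v (cdim G i) \<le> Mmat G i k *\<^sub>v state G x0 ?u k + Nmat G i k *\<^sub>v joint_action G ?u k + rvec G i k"
        using feas' i k by (auto simp: feasible_def action_stages_eq simp del: fun_upd_apply)
      then have "0\<^sub>v (cdim G i) \<le> c i k + ?z"
        unfolding constraint_deviation[OF G x0 i u u' k] c_def d_def w_def .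
      moreover have "0\<^sub>v (cdim G i) \<le> mu i k" and ort: "c i k \<bullet> mu i k = 0"
        using compl[OF i k] mu[OF i k] by (auto simp: complementary_def)
      ultimately have "0 \<le> mu i k \<bullet> (c i k + ?z)" by (intro scalar_prod_nonneg)
      also have "\<dots> = mu i k \<bullet> c i k + mu i k \<bullet> ?z"
        by (rule scalar_prod_add_distrib[OF mu[OF i k] cC[OF i k] zC])
      also have "mu i k \<bullet> c i k = 0"
        using ort comm_scalar_prod[OF mu[OF i k] cC[OF i k]] by simp
      finally show ?thesis by simp
    qed
    \<comment> \<open>\<open>T\<close> is the telescoping quantity, costate term plus Riccati form:
      it vanishes at stage 0 and equals twice the change of the terminal cost at the horizon.
      \<open>L\<close> is twice the stage cost.\<close>
    define T where "T k = 2 * (lam i k \<bullet> d k) + quad (E i k) (d k)" for k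
    define L where "L x u k = quad (Qmat G i k) (x k) + 2 * (pvec G i k \<bullet> x k) +
      (\<Sum>j\<in>players G. quad (Rmat G i j k) (u j k))" for x and u :: "nat \<Rightarrow> nat \<Rightarrow> real vec" and k
    have stage: "L (state G x0 u) u k + T k - T (Suc k) \<le> L (state G x0 ?u) ?u k" if k: "k < ?K" for k
    proof -
      have "quad (Qmat G i k) (x k) + 2 * (pvec G i k \<bullet> x k) + quad (Rmat G i i k) (u i k) + T k - T (Suc k)
        \<le> quad (Qmat G i k) (x k + d k) + 2 * (pvec G i k \<bullet> (x k + d k)) + quad (Rmat G i i k) (u i k + w k)"
        unfolding T_def
      proof (rule stage_cost_increment[OF A[OF k] B[OF i k] M[OF i k] NB Q[OF i] R[OF i k]])
        show "E i (Suc k) \<in> carrier_mat ?n ?n" "symmetric_matrix (E i (Suc k))"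
          using E i k by (auto simp: riccati_solution_def stages_def)
        show "Ymat G E i k = Rmat G i i k + (Bmat G i k)\<^sup>T * E i (Suc k) * Bmat G i k"
          by (simp add: Ymat_def)
        show "positive_definite (Ymat G E i k)"
          using assms(5)[OF E i] k by (simp add: action_stages_eq)
        show "E i k = (Amat G k)\<^sup>T * E i (Suc k) * Amat G k + Qmat G i k -
             (Amat G k)\<^sup>T * E i (Suc k) * Bmat G i k * matinv (Ymat G E i k) *
               (Bmat G i k)\<^sup>T * E i (Suc k) * Amat G k"
          using E i k unfolding riccati_solution_def action_stages_eq Suc_eq_plus1 by blast
        show "lam i k = Qmat G i k *\<^sub>v x k + pvec G i k + (Amat G k)\<^sup>T *\<^sub>v lam i (Suc k)
                  - (Mmat G i k)\<^sup>T *\<^sub>v mu i k"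
          using lcs i k by (simp add: action_stages_eq)
        show "Rmat G i i k *\<^sub>v u i k = - ((Bmat G i k)\<^sup>T *\<^sub>v lam i (Suc k) - (Nblock G i i k)\<^sup>T *\<^sub>v mu i k)"
          using stationary[OF i k] by (simp add: g_def)
      qed (use k i xC dC p uC wC lam mu multiplier dSuc in auto)
      \<comment> \<open>The other players' actions are unchanged, so their control costs contribute
        equally to both sides.\<close>
      moreover have "(\<Sum>j\<in>players G - {i}. quad (Rmat G i j k) (?u j k)) =
          (\<Sum>j\<in>players G - {i}. quad (Rmat G i j k) (u j k))"
        by (intro sum.cong) auto
      moreover have "finite (players G)" by (simp add: players_def)
      ultimately show ?thesis
        using k by (simp add: L_def sum.remove[OF _ i] y state v_eq)
    qed
    \<comment> \<open>\<open>T 0\<close> is zero because both trajectories start at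
      \<open>x0\<close>; inserting it produces the difference that telescopes.\<close>
    have "(\<Sum>k<?K. L (state G x0 u) u k) - T ?K = (\<Sum>k<?K. L (state G x0 u) u k) + (T 0 - T ?K)"
    proof -
      have "E i 0 \<in> carrier_mat ?n ?n"
        using E i by (simp add: riccati_solution_def stages_def)
      then have "T 0 = 0"
        using lam[OF i, of 0] mult_mat_vec_carrier[of "E i 0" ?n ?n "0\<^sub>v ?n"]
        by (simp add: T_def d0 quad_def)
      then show ?thesis by simp
    qed
    also have "\<dots> = (\<Sum>k<?K. L (state G x0 u) u k + T k - T (Suc k))"
      by (simp add: sum.distrib sum_subtractf flip: sum_lessThan_telescope')
    also have "\<dots> \<le> (\<Sum>k<?K. L (state G x0 ?u) ?u k)"
      using stage by (intro sum_mono) auto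
    finally have stages: "(\<Sum>k<?K. L (state G x0 u) u k) - T ?K \<le> (\<Sum>k<?K. L (state G x0 ?u) ?u k)" .
    have QK: "Qmat G i ?K \<in> carrier_mat ?n ?n" "symmetric_matrix (Qmat G i ?K)"
      and pK: "pvec G i ?K \<in> carrier_vec ?n" and xK: "x ?K \<in> carrier_vec ?n"
      and dK: "d ?K \<in> carrier_vec ?n"
      using Q[OF i] p[OF i] xC dC by auto
    have "lam i ?K = Qmat G i ?K *\<^sub>v x ?K + pvec G i ?K" using lcs i by simp
    then have "lam i ?K \<bullet> d ?K = (Qmat G i ?K *\<^sub>v x ?K) \<bullet> d ?K + pvec G i ?K \<bullet> d ?K"
      using QK pK xK dK by (simp add: add_scalar_prod_distrib[of _ ?n])
    also have "(Qmat G i ?K *\<^sub>v x ?K) \<bullet> d ?K = d ?K \<bullet> (Qmat G i ?K *\<^sub>v x ?K)"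
      using QK xK dK by (intro comm_scalar_prod[of _ ?n]) auto
    finally have lamK: "lam i ?K \<bullet> d ?K = d ?K \<bullet> (Qmat G i ?K *\<^sub>v x ?K) + pvec G i ?K \<bullet> d ?K" .
    have EK: "E i ?K = Qmat G i ?K" using E i by (auto simp: riccati_solution_def)
    \<comment> \<open>The boundary conditions on \<open>lam\<close> and \<open>E\<close> make
      \<open>T\<close> at the horizon exactly the terminal increment, so it cancels against the
      boundary term left by the telescoping sum.\<close>
    have terminal: "quad (Qmat G i ?K) (x ?K + d ?K) + 2 * (pvec G i ?K \<bullet> (x ?K + d ?K)) =
        quad (Qmat G i ?K) (x ?K) + 2 * (pvec G i ?K \<bullet> x ?K) + T ?K"
      using quad_add[OF QK(2,1) xK dK] scalar_prod_add_distrib[OF pK xK dK] lamK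
      by (simp add: T_def EK)
    have cost: "cost G x0 i u = 1/2 * (quad (Qmat G i ?K) (state G x0 u ?K) + 2 * (pvec G i ?K \<bullet> state G x0 u ?K)
        + (\<Sum>k<?K. L (state G x0 u) u k))" for u
      by (simp add: cost_def Let_def L_def action_stages_eq)
    show ?thesis
      using stages terminal unfolding cost y[OF order_refl] state[OF order_refl] by simp
  qed
  then have "GOLNE G x0 u" using feasible by (simp add: GOLNE_def)
  then show ?thesis by (simp only: u_def g_def)
qed

end
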